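(* For every $n\ge1$, $\mathcal{Q}^n_1\subseteq\mathcal{Q}^n$. That is, if $Q\in\mathcal{S}^n$ satisfies $\min_{1\le i\le j\le n}Q_{ij}=\min_{k=1,\dots,n}Q_{kk}$, then $\ell(Q)=\nu(Q)$.
   Context: $\mathcal{S}^n$ is the space of real symmetric $n\times n$ matrices, with trace inner product $\langle U,V\rangle=\sum_{i,j}U_{ij}V_{ij}$; $e\in\mathbb{R}^n$ is the all-ones vector, $E=ee^T$; $\Delta_n=\{x\in\mathbb{R}^n: e^Tx=1,\ x\ge 0\}$. $\mathcal{DN}^n$ is the cone of matrices in $\mathcal{S}^n$ that are both positive semidefinite and entrywise nonnegative. For $Q\in\mathcal{S}^n$: $\nu(Q)=\min\{x^TQx: x\in\Delta_n\}$ and $\ell(Q)=\min\{\langle Q,X\rangle:\langle E,X\rangle=1,\ X\in\mathcal{DN}^n\}$. $\mathcal{Q}^n=\{Q\in\mathcal{S}^n:\ell(Q)=\nu(Q)\}$ and $\mathcal{Q}^n_1=\{Q\in\mathcal{S}^n:\min_{1\le i\le j\le n}Q_{ij}=\min_{k=1,\dots,n}Q_{kk}\}$. *)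

theory Defs
  imports "HOL-Analysis.Analysis"
begin

text \<open>
  \<open>\<real>\<^sup>n\<close> is \<^typ>\<open>real ^ 'n\<close>; the dimension \<open>n \<ge> 1\<close> is the cardinality of the arbitrary
  finite index type \<open>'n\<close>.  The order on \<open>'n\<close> is needed only for index ranges \<open>i \<le> j\<close>.
\<close>

definition sym_mats :: "(real ^ 'n ^ 'n) set"
  where "sym_mats = {Q. transpose Q = Q}"

text \<open>
  The inner product \<open>\<bullet>\<close> on \<^typ>\<open>real ^ 'n ^ 'n\<close> is the trace inner product:
\<close>

lemma trace_inner_product:
  fixes U V :: "real ^ 'n ^ 'n"
  shows "U \<bullet> V = (\<Sum>i\<in>UNIV. \<Sum>j\<in>UNIV. U $ i $ j * V $ i $ j)"
  by (simp add: inner_vec_def)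

definition ones_vec :: "real ^ 'n"
  where "ones_vec = (\<chi> i. 1)"

definition ones_mat :: "real ^ 'n ^ 'n"
  where "ones_mat = (\<chi> i j. ones_vec $ i * ones_vec $ j)"

definition std_simplex :: "(real ^ 'n) set"
  where "std_simplex = {x. ones_vec \<bullet> x = 1 \<and> (\<forall>i. 0 \<le> x $ i)}"

definition pos_semidef :: "real ^ 'n ^ 'n \<Rightarrow> bool"
  where "pos_semidef X \<longleftrightarrow> (\<forall>y. 0 \<le> y \<bullet> (X *v y))"

definition DN_cone :: "(real ^ 'n ^ 'n) set"
  where "DN_cone = {X \<in> sym_mats. pos_semidef X \<and> (\<forall>i j. 0 \<le> X $ i $ j)}"

definition DN_slice :: "(real ^ 'n ^ 'n) set"
  where "DN_slice = {X. ones_mat \<bullet> X = 1 \<and> X \<in> DN_cone}"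

text \<open>
  The two minima are written as infima; \<open>nu_attained\<close> and \<open>ell_attained\<close> below show
  that they are attained.
\<close>

definition nu :: "real ^ 'n ^ 'n \<Rightarrow> real"
  where "nu Q = (INF x\<in>std_simplex. x \<bullet> (Q *v x))"

definition ell :: "real ^ 'n ^ 'n \<Rightarrow> real"
  where "ell Q = (INF X\<in>DN_slice. Q \<bullet> X)"

definition Q_exact :: "(real ^ 'n ^ 'n) set"
  where "Q_exact = {Q \<in> sym_mats. ell Q = nu Q}"

definition Q_one :: "(real ^ 'n::{finite,linorder} ^ 'n::{finite,linorder}) set"
  where "Q_one = {Q \<in> sym_mats. Min {Q $ i $ j | i j. i \<le> j} = Min {Q $ k $ k | k. True}}"

lemma INF_attained:
  fixes f :: "'a::topological_space \<Rightarrow> real"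
  assumes "compact S" "S \<noteq> {}" "continuous_on S f"
  shows "\<exists>x\<in>S. f x = (INF y\<in>S. f y) \<and> (\<forall>y\<in>S. f x \<le> f y)"
proof -
  obtain x where x: "x \<in> S" "\<forall>y\<in>S. f x \<le> f y"
    using continuous_attains_inf[OF assms] by blast
  then have "(INF y\<in>S. f y) = f x"
    by (intro cInf_eq_minimum) auto
  with x show ?thesis by auto
qed

lemma axis_in_std_simplex: "axis k 1 \<in> std_simplex"
  by (simp add: std_simplex_def ones_vec_def inner_vec_def axis_def)

lemma compact_std_simplex: "compact (std_simplex :: (real ^ 'n) set)"
proof -
  have eq: "std_simplex = {x :: real ^ 'n. ones_vec \<bullet> x = 1} \<inter> (\<Inter>i. {x. 0 \<le> x $ i})"
    by (auto simp: std_simplex_def)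
  have "closed (std_simplex :: (real ^ 'n) set)"
    unfolding eq
    by (intro closed_Int closed_INT ballI closed_Collect_eq closed_Collect_le continuous_intros)
  moreover have "norm x \<le> 1" if "x \<in> std_simplex" for x :: "real ^ 'n"
  proof -
    have "norm x \<le> (\<Sum>i\<in>UNIV. \<bar>x $ i\<bar>)" by (rule norm_le_l1_cart)
    also have "\<dots> = 1"
      using that by (simp add: std_simplex_def ones_vec_def inner_vec_def)
    finally show ?thesis .
  qed
  then have "bounded (std_simplex :: (real ^ 'n) set)"
    by (auto simp: bounded_iff)
  ultimately show ?thesis by (simp add: compact_eq_bounded_closed)
qed

lemma nu_attained:
  fixes Q :: "real ^ 'n ^ 'n"
  shows "\<exists>x\<in>std_simplex. x \<bullet> (Q *v x) = nu Q \<and>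
    (\<forall>y\<in>std_simplex. x \<bullet> (Q *v x) \<le> y \<bullet> (Q *v y))"
  unfolding nu_def
proof (rule INF_attained)
  show "continuous_on std_simplex (\<lambda>x. x \<bullet> (Q *v x))"
    by (intro continuous_intros linear_continuous_on matrix_vector_mul_bounded_linear)
qed (use compact_std_simplex axis_in_std_simplex in auto)

lemma DN_slice_nonempty: "(DN_slice :: (real ^ 'n ^ 'n) set) \<noteq> {}"
proof -
  fix k :: 'n
  let ?X = "(\<chi> i j. if i = k \<and> j = k then 1 else 0) :: real ^ 'n ^ 'n"
  have entry: "(\<Sum>j\<in>UNIV. (if i = k \<and> j = k then 1 else 0) * f j) = (if i = k then f k else 0)"
    for i and f :: "'n \<Rightarrow> real"
    by (cases "i = k") (simp_all add: if_distrib[of "\<lambda>c. c * _"] cong: if_cong)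
  have row: "(\<Sum>j\<in>UNIV. (if i = k \<and> j = k then 1 else 0)) = (if i = k then 1 else (0::real))"
    for i
    using entry[of i "\<lambda>_. 1"] by simp
  have "y \<bullet> (?X *v y) = y $ k * y $ k" for y
    by (simp add: inner_vec_def matrix_vector_mult_def entry if_distrib[of "\<lambda>c. _ * c"] cong: if_cong)
  then have "pos_semidef ?X" by (simp add: pos_semidef_def)
  moreover have "?X \<in> sym_mats"
    by (simp add: sym_mats_def transpose_def vec_eq_iff conj_commute)
  moreover have "ones_mat \<bullet> ?X = 1"
    by (simp add: ones_mat_def ones_vec_def trace_inner_product row)
  ultimately have "?X \<in> DN_slice"
    by (simp add: DN_slice_def DN_cone_def)
  then show ?thesis by blast
qed

lemma compact_DN_slice: "compact (DN_slice :: (real ^ 'n ^ 'n) set)"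
proof -
  have quad: "y \<bullet> (X *v y) = (\<Sum>i\<in>UNIV. y $ i * (\<Sum>j\<in>UNIV. X $ i $ j * y $ j))"
    for X :: "real ^ 'n ^ 'n" and y
    by (simp add: inner_vec_def matrix_vector_mult_def)
  have eq: "DN_slice = {X :: real ^ 'n ^ 'n. ones_mat \<bullet> X = 1}
      \<inter> (\<Inter>i. \<Inter>j. {X. X $ j $ i = X $ i $ j})
      \<inter> (\<Inter>y. {X. 0 \<le> (\<Sum>i\<in>UNIV. y $ i * (\<Sum>j\<in>UNIV. X $ i $ j * y $ j))})
      \<inter> (\<Inter>i. \<Inter>j. {X. 0 \<le> X $ i $ j})"
    by (auto simp: DN_slice_def DN_cone_def sym_mats_def transpose_def vec_eq_iff
        pos_semidef_def quad)
  have "closed (DN_slice :: (real ^ 'n ^ 'n) set)"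
    unfolding eq
    by (intro closed_Int closed_INT ballI closed_Collect_eq closed_Collect_le continuous_intros)
  moreover have "norm X \<le> 1" if "X \<in> DN_slice" for X :: "real ^ 'n ^ 'n"
  proof -
    have "norm X \<le> (\<Sum>i\<in>UNIV. norm (X $ i))"
      by (simp add: norm_vec_def L2_set_le_sum)
    also have "\<dots> \<le> (\<Sum>i\<in>UNIV. \<Sum>j\<in>UNIV. \<bar>X $ i $ j\<bar>)"
      by (intro sum_mono norm_le_l1_cart)
    also have "\<dots> = 1"
      using that
      by (simp add: DN_slice_def DN_cone_def ones_mat_def ones_vec_def trace_inner_product)
    finally show ?thesis .
  qed
  then have "bounded (DN_slice :: (real ^ 'n ^ 'n) set)"
    by (auto simp: bounded_iff)
  ultimately show ?thesis by (simp add: compact_eq_bounded_closed)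
qed

lemma ell_attained:
  fixes Q :: "real ^ 'n ^ 'n"
  shows "\<exists>X\<in>DN_slice. Q \<bullet> X = ell Q \<and> (\<forall>Y\<in>DN_slice. Q \<bullet> X \<le> Q \<bullet> Y)"
  unfolding ell_def
  by (rule INF_attained) (use compact_DN_slice DN_slice_nonempty in \<open>auto intro!: continuous_intros\<close>)

end

theory Submission
  imports Defs
begin

text \<open>
  For every \<open>x\<close> in the simplex the rank-one matrix \<open>x x\<^sup>T\<close> is feasible for the doubly nonnegative
  relaxation and has objective value \<open>x\<^sup>T Q x\<close>, so \<open>\<ell>(Q) \<le> \<nu>(Q)\<close> always (\<open>ell_le_nu\<close>).  For any
  \<open>Q\<close>, both quantities lie between two elementary bounds.  A feasible \<open>X\<close> has nonnegative entries
  summing to one, so \<open>\<langle>Q, X\<rangle>\<close> is a weighted average of the entries of \<open>Q\<close> and \<open>\<ell>(Q)\<close> is at least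
  the smallest of them (\<open>ell_ge\<close>); a vertex of the simplex picks out a diagonal entry, so \<open>\<nu>(Q)\<close>
  is at most the smallest diagonal entry (\<open>nu_le_diagonal\<close>).  Membership in \<open>Q_one\<close> says
  exactly that the two bounds coincide, which forces \<open>\<ell>(Q) = \<nu>(Q)\<close>.
\<close>

definition outer_square :: "real ^ 'n \<Rightarrow> real ^ 'n ^ 'n"
  where "outer_square x = (\<chi> i j. x $ i * x $ j)"

lemma inner_outer_square:
  fixes A :: "real ^ 'n ^ 'n"
  shows "A \<bullet> outer_square x = x \<bullet> (A *v x)"
  by (simp add: trace_inner_product outer_square_def inner_vec_def matrix_vector_mult_def
      sum_distrib_left algebra_simps)

lemma pos_semidef_outer_square: "pos_semidef (outer_square x)"
proof -
  have "y \<bullet> (outer_square x *v y) = (x \<bullet> y)\<^sup>2" for y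
    by (simp add: outer_square_def inner_vec_def matrix_vector_mult_def power2_eq_square
        sum_product sum_distrib_left algebra_simps)
  then show ?thesis
    by (simp add: pos_semidef_def)
qed

lemma outer_square_in_DN_slice:
  assumes "x \<in> std_simplex"
  shows "outer_square x \<in> DN_slice"
proof -
  have "ones_mat \<bullet> outer_square x = (ones_vec \<bullet> x)\<^sup>2"
    by (simp add: trace_inner_product ones_mat_def ones_vec_def outer_square_def inner_vec_def
        power2_eq_square sum_product)
  moreover have "outer_square x \<in> sym_mats"
    by (simp add: sym_mats_def outer_square_def transpose_def vec_eq_iff mult.commute)
  moreover have "\<forall>i j. 0 \<le> outer_square x $ i $ j"
    using assms by (simp add: std_simplex_def outer_square_def)
  ultimately show ?thesis
    using assms pos_semidef_outer_square by (simp add: DN_slice_def DN_cone_def std_simplex_def)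
qed

lemma ell_le_nu:
  fixes Q :: "real ^ 'n ^ 'n"
  shows "ell Q \<le> nu Q"
proof -
  obtain x where x: "x \<in> std_simplex" "x \<bullet> (Q *v x) = nu Q"
    using nu_attained by blast
  then have "ell Q \<le> Q \<bullet> outer_square x"
    using ell_attained[of Q] outer_square_in_DN_slice by metis
  with x show ?thesis
    by (simp add: inner_outer_square)
qed

lemma ell_ge:
  fixes Q :: "real ^ 'n ^ 'n"
  assumes "\<And>i j. m \<le> Q $ i $ j"
  shows "m \<le> ell Q"
proof -
  obtain X where X: "X \<in> DN_slice" "Q \<bullet> X = ell Q"
    using ell_attained by blast
  have nonneg: "0 \<le> X $ i $ j" for i j
    using X by (simp add: DN_slice_def DN_cone_def)
  have "m = m * (ones_mat \<bullet> X)"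
    using X by (simp add: DN_slice_def)
  also have "\<dots> = (\<Sum>i\<in>UNIV. \<Sum>j\<in>UNIV. m * X $ i $ j)"
    by (simp add: trace_inner_product ones_mat_def ones_vec_def sum_distrib_left)
  also have "\<dots> \<le> Q \<bullet> X"
    unfolding trace_inner_product by (intro sum_mono mult_right_mono assms nonneg)
  finally show ?thesis
    using X by simp
qed

lemma nu_le_diagonal:
  fixes Q :: "real ^ 'n ^ 'n"
  shows "nu Q \<le> Q $ k $ k"
proof -
  have "nu Q \<le> axis k 1 \<bullet> (Q *v axis k 1)"
    using nu_attained[of Q] axis_in_std_simplex[of k] by metis
  also have "\<dots> = Q $ k $ k"
    by (simp add: matrix_vector_mul_component inner_axis inner_axis')
  finally show ?thesis .
qed

theorem proposition4p1:
  shows "(Q_one :: (real ^ 'n::{finite,linorder} ^ 'n::{finite,linorder}) set) \<subseteq> Q_exact"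
proof
  fix Q :: "real ^ 'n::{finite,linorder} ^ 'n::{finite,linorder}"
  assume "Q \<in> Q_one"
  then have sym: "Q \<in> sym_mats"
    and min_eq: "Min {Q $ i $ j | i j. i \<le> j} = Min {Q $ k $ k | k. True}"
    by (auto simp: Q_one_def)
  have "Min {Q $ k $ k | k. True} \<in> {Q $ k $ k | k. True}"
    by (rule Min_in) (auto simp: full_SetCompr_eq)
  then obtain k where k: "Min {Q $ k $ k | k. True} = Q $ k $ k"
    by blast
  have "finite {Q $ i $ j | i j. i \<le> j}"
    by (rule finite_subset[of _ "range (\<lambda>(i, j). Q $ i $ j)"]) auto
  then have upper: "Q $ k $ k \<le> Q $ i $ j" if "i \<le> j" for i j
    using that min_eq k by (metis (mono_tags, lifting) Min_le mem_Collect_eq)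
  \<comment> \<open>The minimum in the hypothesis ranges over the upper triangle; symmetry covers the rest.\<close>
  have "Q $ i $ j = Q $ j $ i" for i j
    using sym by (auto simp: sym_mats_def transpose_def vec_eq_iff)
  then have "Q $ k $ k \<le> Q $ i $ j" for i j
    using upper by (metis linear)
  then have "Q $ k $ k \<le> ell Q"
    by (rule ell_ge)
  then have "ell Q = nu Q"
    using ell_le_nu[of Q] nu_le_diagonal[of Q k] by linarith
  with sym show "Q \<in> Q_exact"
    by (simp add: Q_exact_def)
qed

end
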